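(* Let $\mathbb{F}$ be any field, let $G=([n],E)$ be a directed graph and $\mathcal{S}_G=\langle\mathrm{E}_{i,j}\mid (i,j)\in E\rangle\le\mathrm{M}(n,\mathbb{F})$. The maximum number of arcs in an acyclic spanning subgraph of $G$ equals the largest dimension of a nil subspace of $\mathcal{S}_G$.
   Context: Directed graphs have arc sets $E\subseteq[n]\times[n]$, self-loops allowed and counted as cycles (of length $1$); acyclic means containing no directed cycle. A spanning subgraph has vertex set $[n]$ and arc set contained in $E$. $\mathrm{E}_{i,j}$ is the elementary $n\times n$ matrix with $1$ at $(i,j)$. A matrix space is nil if every matrix in it is nilpotent. *)

theory Defs
  imports "HOL-Analysis.Analysis"
begin

text \<open>
  The vertex set \<open>[n]\<close> is the finite index type \<open>'n\<close>, so \<open>M(n, F)\<close> is \<open>'a^'n^'n\<close> with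
  \<open>'a :: field\<close>, and a directed graph on \<open>[n]\<close> is an arbitrary arc set \<open>E :: ('n \<times> 'n) set\<close>.
  A spanning subgraph keeps all vertices, hence is determined by a subset \<open>D \<subseteq> E\<close>.
\<close>

subsection \<open>Acyclicity\<close>

text \<open>
  The library predicate \<^const>\<open>acyclic\<close> excludes closed walks of positive length. The lemma
  \<open>acyclic_iff_no_dicycle\<close> shows that this is the same as having no directed cycle on pairwise
  distinct vertices, where a self-loop is a cycle of length 1.
\<close>

definition dicycle :: "('v \<times> 'v) set \<Rightarrow> 'v list \<Rightarrow> bool" where
  "dicycle D vs \<longleftrightarrow> vs \<noteq> [] \<and> distinct vs \<and>
     (\<forall>i<length vs. (vs ! i, vs ! (Suc i mod length vs)) \<in> D)"

lemma acyclic_iff_no_dicycle: "acyclic D \<longleftrightarrow> (\<nexists>vs. dicycle D vs)"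
proof
  assume ac: "acyclic D"
  show "\<nexists>vs. dicycle D vs"
  proof
    assume "\<exists>vs. dicycle D vs"
    then obtain vs where vs: "vs \<noteq> []"
      and step: "\<And>i. i < length vs \<Longrightarrow> (vs ! i, vs ! (Suc i mod length vs)) \<in> D"
      by (auto simp: dicycle_def)
    let ?n = "length vs"
    let ?f = "\<lambda>i. vs ! (i mod ?n)"
    have n: "?n > 0" using vs by simp
    have "(?f i, ?f (Suc i)) \<in> D" for i
      using step[of "i mod ?n"] n by (simp add: mod_Suc_eq)
    then have "(?f 0, ?f ?n) \<in> D ^^ ?n"
      unfolding relpow_fun_conv by (rule_tac x = ?f in exI) blast
    then have "(?f 0, ?f 0) \<in> D\<^sup>+"
      using n by (auto simp: trancl_power)
    then show False using ac by (auto simp: acyclic_def)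
  qed
next
  assume no: "\<nexists>vs. dicycle D vs"
  show "acyclic D"
  proof (rule ccontr)
    assume "\<not> acyclic D"
    then have ex: "\<exists>n. n > 0 \<and> (\<exists>x. (x, x) \<in> D ^^ n)"
      by (auto simp: acyclic_def trancl_power)
    define n where "n = (LEAST n. n > 0 \<and> (\<exists>x. (x, x) \<in> D ^^ n))"
    have n: "n > 0" and "\<exists>x. (x, x) \<in> D ^^ n"
      using LeastI_ex[OF ex] by (auto simp: n_def)
    then obtain f where f: "f 0 = f n" "\<And>i. i < n \<Longrightarrow> (f i, f (Suc i)) \<in> D"
      unfolding relpow_fun_conv by metis
    have min: "(x, x) \<notin> D ^^ m" if "0 < m" "m < n" for m x
      using not_less_Least[of m "\<lambda>n. n > 0 \<and> (\<exists>x. (x, x) \<in> D ^^ n)"] that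
      by (auto simp: n_def)
    have neq: "f i \<noteq> f j" if "i < j" "j < n" for i j
    proof
      assume "f i = f j"
      moreover have "(f i, f j) \<in> D ^^ (j - i)"
        unfolding relpow_fun_conv
        using that f(2) by (intro exI[of _ "\<lambda>k. f (i + k)"]) auto
      ultimately show False using min[of "j - i" "f j"] that by simp
    qed
    have "inj_on f {0..<n}"
      by (rule inj_onI) (metis neq atLeastLessThan_iff linorder_neqE_nat)
    moreover have "(f i, f (Suc i mod n)) \<in> D" if "i < n" for i
      using f that by (cases "Suc i = n") (auto simp: less_Suc_eq intro: f(2))
    ultimately have "dicycle D (map f [0..<n])"
      using n by (auto simp: dicycle_def distinct_map)
    then show False using no by blast
  qed
qed

subsection \<open>Matrix spaces\<close>

definition elem_mat :: "'n \<Rightarrow> 'n \<Rightarrow> 'a::field^'n^'n" where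
  "elem_mat i j = (\<chi> k l. if k = i \<and> l = j then 1 else 0)"

definition mat_scale :: "'a::field \<Rightarrow> 'a^'n^'m \<Rightarrow> 'a^'n^'m" where
  "mat_scale c A = (\<chi> i j. c * A $ i $ j)"

global_interpretation mats: vector_space "mat_scale :: 'a::field \<Rightarrow> 'a^'n^'m \<Rightarrow> 'a^'n^'m"
  defines mat_span = mats.span
    and mat_subspace = mats.subspace
    and mat_dim = mats.dim
  by unfold_locales (simp_all add: mat_scale_def vec_eq_iff algebra_simps)

definition graph_space :: "('n \<times> 'n) set \<Rightarrow> ('a::field^'n^'n) set" where
  "graph_space E = mat_span {elem_mat i j | i j. (i, j) \<in> E}"

text \<open>
  The library's power operation on vectors acts componentwise, so powers for the
  matrix product are written as iterated multiplication.
\<close>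

definition nilpotent_mat :: "'a::field^'n^'n \<Rightarrow> bool" where
  "nilpotent_mat A \<longleftrightarrow> (\<exists>k. (((**) A) ^^ k) (mat 1) = 0)"

definition nil_space :: "('a::field^'n^'n) set \<Rightarrow> bool" where
  "nil_space S \<longleftrightarrow> (\<forall>A\<in>S. nilpotent_mat A)"

subsection \<open>Both maxima are taken over finite nonempty sets\<close>

lemma acyclic_card_set:
  fixes E :: "('n::finite \<times> 'n) set"
  shows "finite {card D | D. D \<subseteq> E \<and> acyclic D}" "{card D | D. D \<subseteq> E \<and> acyclic D} \<noteq> {}"
proof -
  show "finite {card D | D. D \<subseteq> E \<and> acyclic D}" by simp
  have "acyclic ({} :: ('n \<times> 'n) set)" by (simp add: acyclic_def)
  then show "{card D | D. D \<subseteq> E \<and> acyclic D} \<noteq> {}" by blast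
qed

lemma nil_dim_set:
  fixes E :: "('n::finite \<times> 'n) set"
  defines "X \<equiv> {mat_dim S | S :: ('a::field^'n^'n) set.
                  mat_subspace S \<and> S \<subseteq> graph_space E \<and> nil_space S}"
  shows "finite X" "X \<noteq> {}"
proof -
  let ?B = "{elem_mat i j :: 'a^'n^'n | i j. (i, j) \<in> E}"
  have "?B = (\<lambda>(i, j). elem_mat i j) ` E" by auto
  then have "finite ?B" by simp
  then have "X \<subseteq> {..card ?B}"
    by (auto simp: X_def graph_space_def intro: mats.dim_le_card)
  then show "finite X" using finite_subset by blast
  have "nilpotent_mat (0 :: 'a^'n^'n)"
    unfolding nilpotent_mat_def by (intro exI[of _ 1]) simp
  then have "nil_space {0 :: 'a^'n^'n}"
    by (simp add: nil_space_def)
  moreover have "{0 :: 'a^'n^'n} \<subseteq> graph_space E"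
    by (simp add: graph_space_def mats.span_zero)
  ultimately show "X \<noteq> {}"
    using mats.subspace_single_0 unfolding X_def by blast
qed

end

theory Submission
  imports Defs
begin

text \<open>
  An acyclic \<open>D \<subseteq> E\<close> spans a nil space of dimension \<open>card D\<close>. For the converse inequality,
  the key point is that a nil space \<open>S\<close> has an index \<open>i\<close> such that no nonzero member of \<open>S\<close>
  is supported in row \<open>i\<close>: otherwise pick such a matrix for every index, follow their nonzero
  entries to a chordless cycle, and note that the matrices along this cycle sum to a matrix that
  is monomial on the cycle, hence not nilpotent. Given such an \<open>i\<close>, the members of \<open>S\<close> with
  vanishing column \<open>i\<close> embed into a nil space on the graph without \<open>i\<close>, and the codimension of
  this subspace is at most the number of arcs \<open>(j, i)\<close> with \<open>j \<noteq> i\<close>. These arcs can be added to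
  an acyclic subgraph of the smaller graph, since \<open>i\<close> has no outgoing arc there.
\<close>

subsection \<open>Digraphs\<close>

text \<open>Each arc from \<open>x\<close> to \<open>z\<close> strictly shrinks the set of
  descendants: \<open>z\<close> is a descendant of \<open>x\<close> but, by acyclicity, not of
  itself. This bounds the length of walks.\<close>

lemma relpow_card_descendants:
  fixes D :: "('n::finite \<times> 'n) set"
  assumes "acyclic D" "(x, y) \<in> D ^^ k"
  shows "k \<le> card (D\<^sup>+ `` {x})"
  using assms(2)
proof (induction k arbitrary: x)
  case (Suc k)
  obtain z where z: "(x, z) \<in> D" "(z, y) \<in> D ^^ k"
    using relpow_Suc_D2[OF Suc.prems] by blast
  have "D\<^sup>+ `` {z} \<subset> D\<^sup>+ `` {x}"
  proof (rule psubsetI)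
    show "D\<^sup>+ `` {z} \<subseteq> D\<^sup>+ `` {x}"
      using z(1) by (auto intro: trancl_into_trancl2)
    show "D\<^sup>+ `` {z} \<noteq> D\<^sup>+ `` {x}"
      using z(1) assms(1) by (auto simp: acyclic_def)
  qed
  then have "card (D\<^sup>+ `` {z}) < card (D\<^sup>+ `` {x})"
    by (intro psubset_card_mono) auto
  then show ?case
    using Suc.IH[OF z(2)] by simp
qed simp

text \<open>Nothing leaves \<open>i\<close> in the enlarged graph, so an added arc can only be the
  last one of a walk. A closed walk through any other vertex therefore lies in
  \<open>D\<close>.\<close>

lemma acyclic_Un_sink:
  assumes "acyclic D" "i \<notin> Domain D" "i \<notin> J"
  shows "acyclic (D \<union> J \<times> {i})"
proof -
  have "y = i \<or> (x, y) \<in> D\<^sup>+" if "(x, y) \<in> (D \<union> J \<times> {i})\<^sup>+" for x y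
    using that
  proof (induction rule: trancl_induct)
    case (step y z)
    then show ?case using assms(2,3) by (auto intro: trancl_into_trancl)
  qed auto
  moreover have "(i, i) \<notin> (D \<union> J \<times> {i})\<^sup>+"
    using assms(2,3) by (auto dest: tranclD)
  ultimately show ?thesis
    using assms(1) unfolding acyclic_def by blast
qed

text \<open>\<open>C\<close> consists of the vertices of a shortest closed walk inside
  \<open>X\<close>; a second arc from one of them back into \<open>C\<close> would close a shorter
  walk.\<close>

lemma chordless_cycle_exists:
  assumes "finite X" "X \<noteq> {}" and out: "\<And>x. x \<in> X \<Longrightarrow> \<exists>y\<in>X. (x, y) \<in> R"
  shows "\<exists>C\<subseteq>X. C \<noteq> {} \<and> (\<forall>c\<in>C. \<exists>!y. y \<in> C \<and> (c, y) \<in> R)"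
proof -
  define Q where "Q = R \<inter> X \<times> X"
  have "\<not> acyclic Q"
  proof
    assume "acyclic Q"
    moreover have "finite Q" using assms(1) by (simp add: Q_def)
    \<comment> \<open>Well-foundedness of the converse yields a sink of \<open>Q\<close> in
      \<open>X\<close>, which contradicts \<open>out\<close>.\<close>
    ultimately have "wf (Q\<inverse>)" by (simp add: finite_acyclic_wf_converse)
    moreover obtain x where "x \<in> X" using assms(2) by blast
    ultimately obtain z where z: "z \<in> X" "\<And>y. (y, z) \<in> Q\<inverse> \<Longrightarrow> y \<notin> X"
      by (rule wfE_min) blast
    obtain y where "y \<in> X" "(z, y) \<in> R" using out z(1) by blast
    then show False using z(1) z(2)[of y] by (simp add: Q_def)
  qed
  then have ex: "\<exists>n. n > 0 \<and> (\<exists>x. (x, x) \<in> Q ^^ n)"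
    by (auto simp: acyclic_def trancl_power)
  define n where "n = (LEAST n. n > 0 \<and> (\<exists>x. (x, x) \<in> Q ^^ n))"
  have n: "n > 0" and "\<exists>x. (x, x) \<in> Q ^^ n"
    using LeastI_ex[OF ex] by (auto simp: n_def)
  then obtain f where f: "f 0 = f n" "\<And>i. i < n \<Longrightarrow> (f i, f (Suc i)) \<in> Q"
    unfolding relpow_fun_conv by metis
  have min: "n \<le> m" if "0 < m" "(x, x) \<in> Q ^^ m" for m x
    unfolding n_def using that by (intro Least_le) auto
  \<comment> \<open>The closed walk is repeated with period \<open>n\<close>, so that it can be
    started at any of its vertices.\<close>
  define g where "g i = f (i mod n)" for i
  have g: "(g i, g (Suc i)) \<in> Q" for i
  proof (cases "Suc (i mod n) = n")
    case True
    then have "g (Suc i) = f n" by (simp add: g_def mod_Suc f(1))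
    then show ?thesis using f(2)[of "i mod n"] n True by (simp add: g_def)
  next
    case False
    then have "g (Suc i) = f (Suc (i mod n))" by (simp add: g_def mod_Suc)
    then show ?thesis using f(2)[of "i mod n"] n by (simp add: g_def)
  qed
  have walk: "(g i, g (i + m)) \<in> Q ^^ m" for i m
    unfolding relpow_fun_conv using g by (intro exI[of _ "\<lambda>k. g (i + k)"]) auto
  have per: "g (i + n) = g i" for i by (simp add: g_def)
  have chordless: "g j = g (Suc i)" if Q: "(g i, g j) \<in> Q" for i j
  proof -
    \<comment> \<open>\<open>Suc i + d\<close> is \<open>j\<close> moved by periods into the window from \<open>Suc i\<close> to \<open>i + n\<close> (the summand
        \<open>n * Suc i\<close> prevents truncation), so the arc closes up the walk from there to \<open>i + n\<close>.\<close>
    define d where "d = (j + n * Suc i - Suc i) mod n"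
    have "Suc i \<le> j + n * Suc i" using n by (cases n) auto
    then have eq: "Suc i + (j + n * Suc i - Suc i) = j + n * Suc i" by (rule le_add_diff_inverse)
    have "(Suc i + d) mod n = (j + n * Suc i) mod n"
      unfolding d_def mod_add_right_eq eq ..
    also have "\<dots> = j mod n" by (rule mod_mult_self2)
    finally have d: "g (Suc i + d) = g j" "d < n" using n by (auto simp: g_def d_def)
    have "(g j, g (i + n)) \<in> Q ^^ (n - Suc d)"
      using walk[of "Suc i + d" "n - Suc d"] d by simp
    then have "(g i, g i) \<in> Q ^^ Suc (n - Suc d)"
      by (intro relpow_Suc_I2[OF Q]) (simp add: per)
    then have "n \<le> Suc (n - Suc d)" using min by blast
    then have "d = 0" using d(2) by linarith
    then show ?thesis using d(1) by simp
  qed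
  have sub: "range g \<subseteq> X" using g by (auto simp: Q_def)
  moreover have "\<forall>c\<in>range g. \<exists>!y. y \<in> range g \<and> (c, y) \<in> R"
  proof
    fix c assume "c \<in> range g"
    then obtain i where c: "c = g i" by blast
    show "\<exists>!y. y \<in> range g \<and> (c, y) \<in> R"
    proof (rule ex1I[of _ "g (Suc i)"])
      show "g (Suc i) \<in> range g \<and> (c, g (Suc i)) \<in> R"
        using g[of i] c by (auto simp: Q_def)
      fix y assume "y \<in> range g \<and> (c, y) \<in> R"
      then show "y = g (Suc i)"
        using chordless[of i] sub by (auto simp: Q_def c)
    qed
  qed
  ultimately show ?thesis by blast
qed

subsection \<open>Nilpotent matrices\<close>

lemma matrix_mult_nth: "(A ** B) $ i $ j = (\<Sum>k\<in>UNIV. A $ i $ k * B $ k $ j)"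
  by (simp add: matrix_matrix_mult_def)

lemma elem_mat_nth: "elem_mat i j $ k $ l = (if k = i \<and> l = j then 1 else 0)"
  by (simp add: elem_mat_def)

lemma graph_space_mono: "D \<subseteq> E \<Longrightarrow> graph_space D \<subseteq> graph_space E"
  unfolding graph_space_def by (intro mats.span_mono) blast

lemma graph_space_iff:
  fixes A :: "'a::field^'n::finite^'n"
  shows "A \<in> graph_space E \<longleftrightarrow> (\<forall>i j. A $ i $ j \<noteq> 0 \<longrightarrow> (i, j) \<in> E)"
proof
  assume "A \<in> graph_space E"
  then show "\<forall>i j. A $ i $ j \<noteq> 0 \<longrightarrow> (i, j) \<in> E"
    unfolding graph_space_def
  proof (induction rule: mats.span_induct_alt)
    case (step c x y)
    then obtain p q where "x = elem_mat p q" "(p, q) \<in> E" by blast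
    then show ?case using step(2)
      by (auto simp: elem_mat_nth mat_scale_def split: if_splits)
  qed simp
next
  assume *: "\<forall>i j. A $ i $ j \<noteq> 0 \<longrightarrow> (i, j) \<in> E"
  have "A = (\<Sum>(i, j)\<in>E. mat_scale (A $ i $ j) (elem_mat i j))"
  proof -
    have "(\<Sum>(i, j)\<in>E. mat_scale (A $ i $ j) (elem_mat i j)) $ k $ l = A $ k $ l" for k l
    proof -
      have "(\<Sum>(i, j)\<in>E. mat_scale (A $ i $ j) (elem_mat i j)) $ k $ l =
            (\<Sum>p\<in>E. if p = (k, l) then A $ k $ l else 0)"
        unfolding sum_component by (intro sum.cong refl) (auto simp: mat_scale_def elem_mat_nth split: if_splits)
      then show ?thesis using * by auto
    qed
    then show ?thesis by (simp add: vec_eq_iff)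
  qed
  also have "\<dots> \<in> graph_space E"
    unfolding graph_space_def by (intro mats.span_sum) (clarify, intro mats.span_scale mats.span_base, blast)
  finally show "A \<in> graph_space E" .
qed

text \<open>With the indices in \<open>C\<close> listed first, \<open>A\<close> is block upper
  triangular, and its \<open>C\<close> block has exactly one nonzero entry in each row. No
  cancellation can occur in powers of such a block, so they never vanish.\<close>

lemma not_nilpotent_mat_if_monomial_block:
  fixes A :: "'a::field^'n::finite^'n"
  assumes "C \<noteq> {}"
    and mono: "\<And>c. c \<in> C \<Longrightarrow> \<exists>!y. y \<in> C \<and> A $ c $ y \<noteq> 0"
    and block: "\<And>z y. z \<notin> C \<Longrightarrow> y \<in> C \<Longrightarrow> A $ z $ y = 0"
  shows "\<not> nilpotent_mat A"
proof -
  let ?P = "\<lambda>k. (((**) A) ^^ k) (mat 1)"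
  have off: "?P k $ z $ y = 0" if "z \<notin> C" "y \<in> C" for k z y
    using that
  proof (induction k arbitrary: z)
    case 0
    then show ?case by (auto simp: mat_def)
  next
    case (Suc k)
    have "A $ z $ w * ?P k $ w $ y = 0" for w
      using Suc block by (cases "w \<in> C") auto
    then show ?case
      unfolding funpow.simps o_apply matrix_mult_nth by (intro sum.neutral ballI)
  qed
  have on: "\<exists>y\<in>C. ?P k $ c $ y \<noteq> 0" if "c \<in> C" for k c
    using that
  proof (induction k arbitrary: c)
    case 0
    then show ?case by (auto simp: mat_def)
  next
    case (Suc k)
    obtain s where s: "s \<in> C" "A $ c $ s \<noteq> 0"
      and u: "\<And>w. w \<in> C \<Longrightarrow> w \<noteq> s \<Longrightarrow> A $ c $ w = 0"
      using mono[OF Suc.prems] by blast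
    obtain y where y: "y \<in> C" "?P k $ s $ y \<noteq> 0" using Suc.IH[OF s(1)] by blast
    have "?P (Suc k) $ c $ y = (\<Sum>w\<in>UNIV. A $ c $ w * ?P k $ w $ y)"
      by (simp add: matrix_mult_nth)
    \<comment> \<open>Only \<open>w = s\<close> survives: other \<open>w\<close> in \<open>C\<close>
      vanish by uniqueness in row \<open>c\<close>, and \<open>w\<close> outside \<open>C\<close> by
      \<open>off\<close>.\<close>
    also have "\<dots> = (\<Sum>w\<in>UNIV. if w = s then A $ c $ s * ?P k $ s $ y else 0)"
    proof (intro sum.cong refl)
      fix w show "A $ c $ w * ?P k $ w $ y = (if w = s then A $ c $ s * ?P k $ s $ y else 0)"
        using u off y(1) by (cases "w \<in> C") (auto simp: s(1))
    qed
    also have "\<dots> = A $ c $ s * ?P k $ s $ y" by simp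
    finally have "?P (Suc k) $ c $ y = A $ c $ s * ?P k $ s $ y" .
    then have "?P (Suc k) $ c $ y \<noteq> 0" using s(2) y(2) by simp
    then show ?case using y(1) by blast
  qed
  have "?P k \<noteq> 0" for k
    using assms(1) on[of _ k] by fastforce
  then show ?thesis by (simp add: nilpotent_mat_def)
qed

text \<open>Stands for deleting vertex \<open>i\<close> without changing the matrix type; it is
  applied to subspaces whose column \<open>i\<close> is already zero. A matrix with
  \<open>zero_row i A = 0\<close> is one supported in row \<open>i\<close>.\<close>

definition zero_row :: "'n \<Rightarrow> 'a::field^'n^'n \<Rightarrow> 'a^'n^'n" where
  "zero_row i A = (\<chi> r c. if r = i then 0 else A $ r $ c)"

text \<open>Since column \<open>i\<close> of \<open>A\<close> is zero, row \<open>i\<close> of a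
  power never feeds into the other rows of the next one. Hence the powers of both matrices agree
  outside row \<open>i\<close>.\<close>

lemma nilpotent_mat_zero_row:
  fixes A :: "'a::field^'n::finite^'n"
  assumes "nilpotent_mat A" and col: "\<And>r. A $ r $ i = 0"
  shows "nilpotent_mat (zero_row i A)"
proof -
  let ?B = "zero_row i A"
  let ?P = "\<lambda>A k. (((**) A) ^^ k) (mat 1)"
  have eq: "?P ?B k $ r $ c = ?P A k $ r $ c" if "r \<noteq> i" for k r c
    using that
  proof (induction k arbitrary: r)
    case (Suc k)
    have "?B $ r $ w * ?P ?B k $ w $ c = A $ r $ w * ?P A k $ w $ c" for w
      using Suc col by (cases "w = i") (auto simp: zero_row_def)
    then show ?case by (simp add: matrix_mult_nth)
  qed simp
  obtain k where "?P A k = 0" using assms(1) by (auto simp: nilpotent_mat_def)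
  \<comment> \<open>A successor exponent puts \<open>?B\<close> on the left of the product, which
    makes row \<open>i\<close> zero; the other rows come from \<open>eq\<close>.\<close>
  then have "?P A (Suc k) = 0" by simp
  then have "?P ?B (Suc k) $ r $ c = 0" for r c
  proof (cases "r = i")
    case True
    then show ?thesis by (simp add: matrix_mult_nth zero_row_def)
  next
    case False
    then show ?thesis using eq \<open>?P A (Suc k) = 0\<close> by (metis zero_index)
  qed
  then have "?P ?B (Suc k) = 0" by (simp add: vec_eq_iff)
  then show ?thesis unfolding nilpotent_mat_def by blast
qed

text \<open>A nonzero entry of the \<open>k\<close>-th power yields a walk of length
  \<open>k\<close> in \<open>D\<close>, and such walks have at most \<open>CARD('n)\<close>
  arcs.\<close>

lemma nilpotent_mat_if_acyclic_support:
  fixes A :: "'a::field^'n::finite^'n"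
  assumes "acyclic D" "A \<in> graph_space D"
  shows "nilpotent_mat A"
proof -
  let ?P = "\<lambda>k. (((**) A) ^^ k) (mat 1)"
  have supp: "(x, y) \<in> D ^^ k" if "?P k $ x $ y \<noteq> 0" for k x y
    using that
  proof (induction k arbitrary: x)
    case 0
    then show ?case by (auto simp: mat_def split: if_splits)
  next
    case (Suc k)
    then obtain w where "A $ x $ w * ?P k $ w $ y \<noteq> 0"
      by (auto simp: matrix_mult_nth elim: sum.not_neutral_contains_not_neutral)
    then have "(x, w) \<in> D" "(w, y) \<in> D ^^ k"
      using Suc.IH[of w] assms(2) by (auto simp: graph_space_iff)
    then show ?case by (rule relpow_Suc_I2)
  qed
  have "?P (Suc CARD('n)) $ x $ y = 0" for x y
  proof (rule ccontr)
    assume "?P (Suc CARD('n)) $ x $ y \<noteq> 0"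
    then have "Suc CARD('n) \<le> card (D\<^sup>+ `` {x})"
      using supp relpow_card_descendants[OF assms(1)] by blast
    also have "\<dots> \<le> CARD('n)" by (intro card_mono) auto
    finally show False by simp
  qed
  then have "?P (Suc CARD('n)) = 0" by (simp add: vec_eq_iff)
  then show ?thesis unfolding nilpotent_mat_def by blast
qed

subsection \<open>Dimensions\<close>

text \<open>The elementary matrices of \<open>D\<close> are independent: every matrix in the span of
  those for the other arcs has a zero at \<open>(i, j)\<close>.\<close>

lemma dim_graph_space:
  fixes D :: "('n::finite \<times> 'n) set"
  shows "mat_dim (graph_space D :: ('a::field^'n^'n) set) = card D"
proof -
  let ?e = "\<lambda>(i, j). elem_mat i j :: 'a^'n^'n"
  have B: "{elem_mat i j | i j. (i, j) \<in> F} = ?e ` F" for F by auto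
  have inj: "inj ?e"
    by (rule injI) (clarsimp, metis elem_mat_nth zero_neq_one)
  have "mats.independent (?e ` D)"
    unfolding mats.dependent_def
  proof clarify
    fix i j assume ij: "(i, j) \<in> D"
      and "elem_mat i j \<in> mat_span (?e ` D - {elem_mat i j :: 'a^'n^'n})"
    moreover have "?e ` D - {elem_mat i j} = ?e ` (D - {(i, j)})"
      using inj ij by (auto simp: inj_def)
    ultimately have "(elem_mat i j :: 'a^'n^'n) \<in> graph_space (D - {(i, j)})"
      unfolding graph_space_def B by simp
    moreover have "(elem_mat i j :: 'a^'n^'n) $ i $ j \<noteq> 0" by (simp add: elem_mat_nth)
    ultimately show False unfolding graph_space_iff by blast
  qed
  then have "mat_dim (graph_space D :: ('a^'n^'n) set) = card (?e ` D)"
    unfolding graph_space_def B by (rule mats.dim_span_eq_card_independent)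
  then show ?thesis
    using inj by (simp add: card_image inj_on_subset)
qed

lemma finite_basis_of_matrix_subspace:
  fixes V :: "('a::field^'n::finite^'n) set"
  obtains B where "B \<subseteq> V" "finite B" "mats.independent B" "V \<subseteq> mat_span B" "card B = mat_dim V"
proof -
  obtain B where B: "B \<subseteq> V" "mats.independent B" "V \<subseteq> mat_span B" "card B = mat_dim V"
    using mats.basis_exists by blast
  let ?U = "{elem_mat i j :: 'a^'n^'n | i j. (i, j) \<in> UNIV}"
  have "?U = (\<lambda>(i, j). elem_mat i j) ` UNIV" by auto
  then have "finite ?U" by simp
  moreover have "B \<subseteq> mat_span ?U"
    using graph_space_iff[of _ UNIV] by (auto simp: graph_space_def)
  ultimately have "finite B"
    using mats.independent_span_bound B(2) by blast
  then show thesis using B that by blast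
qed

text \<open>One linear condition costs at most one dimension: a member \<open>v\<close> violating it
  spans a complement.\<close>

lemma dim_le_dim_entry_zero:
  fixes V :: "('a::field^'n::finite^'n) set"
  assumes V: "mat_subspace V"
  shows "mat_dim V \<le> Suc (mat_dim {A \<in> V. A $ r $ c = 0})"
proof -
  let ?U = "{A \<in> V. A $ r $ c = 0}"
  obtain B where B: "finite B" "?U \<subseteq> mat_span B" "card B = mat_dim ?U"
    by (rule finite_basis_of_matrix_subspace[of ?U])
  obtain v where v: "V \<subseteq> mat_span (insert v B)"
  proof (cases "\<forall>A\<in>V. A $ r $ c = 0")
    case True
    then have "V \<subseteq> mat_span (insert 0 B)"
      using B(2) mats.span_mono[of B "insert 0 B"] by blast
    then show thesis using that by blast
  next
    case False
    then obtain v where v: "v \<in> V" "v $ r $ c \<noteq> 0" by blast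
    have "A \<in> mat_span (insert v B)" if "A \<in> V" for A
    proof -
      \<comment> \<open>This multiple of \<open>v\<close> cancels the entry of \<open>A\<close> at
        \<open>(r, c)\<close>.\<close>
      let ?k = "A $ r $ c / v $ r $ c"
      have "A - mat_scale ?k v \<in> ?U"
        using v that V by (simp add: mats.subspace_diff mats.subspace_scale)
                          (simp add: mat_scale_def)
      then show ?thesis
        using B(2) unfolding mats.span_breakdown_eq by blast
    qed
    then show thesis using that by blast
  qed
  have "mat_dim V \<le> card (insert v B)"
    using v B(1) by (intro mats.dim_le_card) auto
  also have "\<dots> \<le> Suc (mat_dim ?U)"
    using B by (simp add: card_insert_if)
  finally show ?thesis .
qed

lemma dim_le_dim_entries_zero:
  fixes V :: "('a::field^'n::finite^'n) set"
  assumes V: "mat_subspace V" and "finite J"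
  shows "mat_dim V \<le> mat_dim {A \<in> V. \<forall>j\<in>J. A $ j $ i = 0} + card J"
  using \<open>finite J\<close>
proof (induction J rule: finite_induct)
  case (insert j J)
  let ?U = "{A \<in> V. \<forall>j\<in>J. A $ j $ i = 0}"
  have "mat_subspace ?U"
    using V by (auto simp: mats.subspace_def) (auto simp: mat_scale_def)
  then have "mat_dim ?U \<le> Suc (mat_dim {A \<in> ?U. A $ j $ i = 0})"
    by (rule dim_le_dim_entry_zero)
  moreover have "{A \<in> ?U. A $ j $ i = 0} = {A \<in> V. \<forall>j\<in>insert j J. A $ j $ i = 0}"
    by auto
  ultimately show ?case using insert by simp
qed simp

lemma linear_zero_row:
  "Vector_Spaces.linear mat_scale mat_scale (zero_row i :: 'a::field^'n::finite^'n \<Rightarrow> _)"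
  unfolding Vector_Spaces.linear_iff
  by (simp add: mats.vector_space_axioms zero_row_def mat_scale_def vec_eq_iff)

text \<open>On \<open>U\<close> the linear map \<open>zero_row i\<close> has trivial kernel, so it
  keeps a basis independent.\<close>

lemma dim_le_dim_zero_row_image:
  fixes U :: "('a::field^'n::finite^'n) set"
  assumes U: "mat_subspace U"
    and inj: "\<And>A. A \<in> U \<Longrightarrow> zero_row i A = 0 \<Longrightarrow> A = 0"
  shows "mat_dim U \<le> mat_dim (zero_row i ` U)"
proof -
  interpret vector_space_pair "mat_scale :: 'a \<Rightarrow> 'a^'n^'n \<Rightarrow> _" "mat_scale :: 'a \<Rightarrow> 'a^'n^'n \<Rightarrow> _" ..
  obtain B where B: "B \<subseteq> U" "mats.independent B" "card B = mat_dim U"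
    by (rule finite_basis_of_matrix_subspace[of U])
  obtain B' where B': "finite B'" "zero_row i ` U \<subseteq> mat_span B'"
      "card B' = mat_dim (zero_row i ` U)"
    by (rule finite_basis_of_matrix_subspace[of "zero_row i ` U"])
  have "inj_on (zero_row i) U"
    using linear_inj_on_iff_eq_0[OF linear_zero_row U[unfolded mat_subspace_def]] inj by blast
  moreover have "mat_span B \<subseteq> U" using B(1) U by (rule mats.span_minimal)
  ultimately have inj': "inj_on (zero_row i) (mat_span B)" by (rule inj_on_subset)
  then have "mats.independent (zero_row i ` B)"
    using B(2) unfolding mat_span_def
    by (intro linear_independent_injective_image[OF linear_zero_row])
  moreover have "zero_row i ` B \<subseteq> mat_span B'" using B(1) B'(2) by blast
  ultimately have "card (zero_row i ` B) \<le> card B'"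
    using mats.independent_span_bound B'(1) by blast
  moreover have "card (zero_row i ` B) = card B"
    using inj' mats.span_superset by (intro card_image) (rule inj_on_subset)
  ultimately show ?thesis using B(3) B'(3) by simp
qed

subsection \<open>Nil spaces\<close>

lemma nil_space_row_free_index:
  fixes V :: "('a::field^'n::finite^'n) set"
  assumes V: "mat_subspace V" "nil_space V" "V \<subseteq> graph_space (X \<times> X)" and "X \<noteq> {}"
  shows "\<exists>i\<in>X. \<forall>A\<in>V. zero_row i A = 0 \<longrightarrow> A = 0"
proof (rule ccontr)
  assume "\<not> ?thesis"
  then obtain M where M: "\<And>i. i \<in> X \<Longrightarrow> M i \<in> V \<and> zero_row i (M i) = 0 \<and> M i \<noteq> 0"
    by metis
  have row: "M i $ r $ c = 0" if "i \<in> X" "r \<noteq> i" for i r c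
    proof -
    have "zero_row i (M i) $ r $ c = 0" using M[OF that(1)] by simp
    then show ?thesis using that(2) by (simp add: zero_row_def)
  qed
  \<comment> \<open>Arcs of \<open>R\<close> out of \<open>i\<close> mark the nonzero entries of the
    only nonzero row of \<open>M i\<close>.\<close>
  define R where "R = {(i, j). M i $ i $ j \<noteq> 0}"
  have "\<exists>y\<in>X. (x, y) \<in> R" if x: "x \<in> X" for x
  proof -
    obtain r y where y: "M x $ r $ y \<noteq> 0"
      using M[OF x] by (auto simp: vec_eq_iff)
    then have "r = x" using row x by blast
    moreover have "y \<in> X" using y M[OF x] V(3) by (auto simp: graph_space_iff)
    ultimately show ?thesis using y by (auto simp: R_def)
  qed
  then obtain C where C: "C \<subseteq> X" "C \<noteq> {}" "\<And>c. c \<in> C \<Longrightarrow> \<exists>!y. y \<in> C \<and> (c, y) \<in> R"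
    using chordless_cycle_exists[of X R] \<open>X \<noteq> {}\<close> by (metis finite)
  define A where "A = (\<Sum>c\<in>C. M c)"
  have "A \<in> V" unfolding A_def using C(1) M V(1) by (intro mats.subspace_sum) auto
  \<comment> \<open>Each summand contributes only its own row, so nothing is added up within a row,
    and the rows of \<open>A\<close> outside \<open>C\<close> are zero.\<close>
  have entry: "A $ r $ y = (if r \<in> C then M r $ r $ y else 0)" for r y
  proof -
    have "A $ r $ y = (\<Sum>c\<in>C. if c = r then M r $ r $ y else 0)"
      unfolding A_def sum_component using row C(1) by (intro sum.cong) auto
    then show ?thesis by simp
  qed
  have "\<not> nilpotent_mat A"
    using C by (intro not_nilpotent_mat_if_monomial_block[of C]) (auto simp: entry R_def)
  then show False using \<open>A \<in> V\<close> V(2) by (auto simp: nil_space_def)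
qed

text \<open>Induction on \<open>X\<close>, the vertices still in play; the index type stays fixed,
  while \<open>V\<close> and \<open>E\<close> shrink along with \<open>X\<close>.\<close>

lemma nil_space_dim_le_acyclic:
  fixes V :: "('a::field^'n::finite^'n) set"
  assumes "mat_subspace V" "nil_space V" "V \<subseteq> graph_space E" "E \<subseteq> X \<times> X"
  shows "\<exists>D\<subseteq>E. acyclic D \<and> mat_dim V \<le> card D"
proof -
  have "finite X" by simp
  then show ?thesis using assms
  proof (induction X arbitrary: V E rule: finite_psubset_induct)
    case (psubset X)
    note V = psubset.prems
    show ?case
    proof (cases "X = {}")
      case True
      then have "V \<subseteq> mat_span {}" using V(3,4) by (simp add: graph_space_def)
      then have "mat_dim V \<le> 0" using mats.dim_le_card[of V "{}"] by simp
      then show ?thesis by (auto simp: acyclic_def intro!: exI[of _ "{}"])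
    next
      case False
      have "V \<subseteq> graph_space (X \<times> X)"
        using V(3,4) graph_space_mono by blast
      then obtain i where i: "i \<in> X" "\<And>A. A \<in> V \<Longrightarrow> zero_row i A = 0 \<Longrightarrow> A = 0"
        using nil_space_row_free_index[OF V(1,2) _ False] by blast
      \<comment> \<open>A loop at \<open>i\<close> is left out: it could not be added to an acyclic
        graph, and nilpotency already forces its entry to vanish on \<open>U\<close>.\<close>
      define J where "J = {j. (j, i) \<in> E \<and> j \<noteq> i}"
      define U where "U = {A \<in> V. \<forall>j\<in>J. A $ j $ i = 0}"
      define E' where "E' = E \<inter> (X - {i}) \<times> (X - {i})"
      have U: "mat_subspace U"
        using V(1) unfolding U_def by (auto simp: mats.subspace_def) (auto simp: mat_scale_def)
      have col: "A $ r $ i = 0" if "A \<in> U" for A r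
      proof -
        have off: "A $ r $ i = 0" if "r \<noteq> i" for r
        proof (rule ccontr)
          assume "A $ r $ i \<noteq> 0"
          moreover have "A \<in> graph_space E" using \<open>A \<in> U\<close> V(3) by (auto simp: U_def)
          ultimately show False using that \<open>A \<in> U\<close> by (auto simp: U_def J_def graph_space_iff)
        qed
        \<comment> \<open>With the rest of column \<open>i\<close> zero, a nonzero diagonal entry
          would make \<open>{i}\<close> a block as in
          \<open>not_nilpotent_mat_if_monomial_block\<close>.\<close>
        moreover have "A $ i $ i = 0"
        proof (rule ccontr)
          assume "A $ i $ i \<noteq> 0"
          then have "\<not> nilpotent_mat A"
            using off by (intro not_nilpotent_mat_if_monomial_block[of "{i}"]) auto
          then show False using \<open>A \<in> U\<close> V(2) by (auto simp: U_def nil_space_def)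
        qed
        ultimately show ?thesis by (cases "r = i") auto
      qed
      have "mat_subspace (zero_row i ` U)"
      proof -
        interpret vector_space_pair "mat_scale :: 'a \<Rightarrow> 'a^'n^'n \<Rightarrow> _"
          "mat_scale :: 'a \<Rightarrow> 'a^'n^'n \<Rightarrow> _" ..
        show ?thesis
          using linear_subspace_image[OF linear_zero_row U[unfolded mat_subspace_def]]
          unfolding mat_subspace_def .
      qed
      moreover have "nil_space (zero_row i ` U)"
        using V(2) col by (auto simp: nil_space_def U_def intro!: nilpotent_mat_zero_row)
      moreover have "zero_row i ` U \<subseteq> graph_space E'"
      proof clarify
        fix A assume A: "A \<in> U"
        have "(r, c) \<in> E'" if "zero_row i A $ r $ c \<noteq> 0" for r c
        proof -
          have "r \<noteq> i" "A $ r $ c \<noteq> 0" using that by (auto simp: zero_row_def split: if_splits)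
          moreover from this have "c \<noteq> i" using col[OF A] by blast
          moreover have "A \<in> graph_space E" using A V(3) by (auto simp: U_def)
          ultimately show ?thesis using V(4) by (auto simp: E'_def graph_space_iff)
        qed
        then show "zero_row i A \<in> graph_space E'" by (simp add: graph_space_iff)
      qed
      moreover have "E' \<subseteq> (X - {i}) \<times> (X - {i})" by (auto simp: E'_def)
      moreover have "X - {i} \<subset> X" using i(1) by blast
      ultimately obtain D where D: "D \<subseteq> E'" "acyclic D" "mat_dim (zero_row i ` U) \<le> card D"
        using psubset.IH by meson
      have "mat_dim U \<le> mat_dim (zero_row i ` U)"
        using i(2) by (intro dim_le_dim_zero_row_image[OF U]) (auto simp: U_def)
      moreover have "mat_dim V \<le> mat_dim U + card J"
        unfolding U_def by (intro dim_le_dim_entries_zero V(1)) simp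
      \<comment> \<open>Disjoint because arcs of \<open>D\<close> avoid \<open>i\<close>, while all
        the added arcs end there.\<close>
      moreover have "card (D \<union> J \<times> {i}) = card D + card J"
        using D(1) by (subst card_Un_disjoint) (auto simp: E'_def)
      ultimately have "mat_dim V \<le> card (D \<union> J \<times> {i})"
        using D(3) by simp
      moreover have "acyclic (D \<union> J \<times> {i})"
        using D by (intro acyclic_Un_sink) (auto simp: E'_def J_def)
      moreover have "D \<union> J \<times> {i} \<subseteq> E" using D(1) by (auto simp: E'_def J_def)
      ultimately show ?thesis by blast
    qed
  qed
qed

theorem theorem1p9:
  fixes E :: "('n::finite \<times> 'n) set"
  shows "Max {card D | D. D \<subseteq> E \<and> acyclic D} =
         Max {mat_dim S | S :: ('a::field^'n^'n) set.
                mat_subspace S \<and> S \<subseteq> graph_space E \<and> nil_space S}"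
    (is "Max ?L = Max ?R")
proof (rule antisym)
  have L: "finite ?L" "?L \<noteq> {}" by (rule acyclic_card_set)+
  have R: "finite ?R" "?R \<noteq> {}" by (rule nil_dim_set)+
  \<comment> \<open>Each size on the left is itself a dimension on the right, realised by
    \<open>graph_space D\<close>.\<close>
  have "card D \<in> ?R" if D: "D \<subseteq> E" "acyclic D" for D
  proof -
    let ?S = "graph_space D :: ('a^'n^'n) set"
    have "mat_subspace ?S" unfolding graph_space_def by (rule mats.subspace_span)
    moreover have "?S \<subseteq> graph_space E" using D(1) by (rule graph_space_mono)
    moreover have "nil_space ?S"
      unfolding nil_space_def by (intro ballI nilpotent_mat_if_acyclic_support[OF D(2)])
    ultimately show ?thesis using dim_graph_space[of D, where 'a = 'a, symmetric] by blast
  qed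
  then show "Max ?L \<le> Max ?R"
    using L R by (intro Max_mono) auto
  have "d \<le> Max ?L" if d: "d \<in> ?R" for d
  proof -
    obtain S :: "('a^'n^'n) set" where "d = mat_dim S" "mat_subspace S" "S \<subseteq> graph_space E"
        "nil_space S"
      using d by blast
    then obtain D where D: "D \<subseteq> E" "acyclic D" "d \<le> card D"
      using nil_space_dim_le_acyclic[of S E UNIV] by auto
    then have "card D \<le> Max ?L" using L(1) by (intro Max_ge) auto
    then show ?thesis using D(3) by simp
  qed
  then show "Max ?R \<le> Max ?L" using R by simp
qed

end
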